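(* Assume $\epsilon=0$ and the following hold: (A1) for every $z\in\mathcal{Z}$ the map $x\mapsto l(x,z)$ is $\gamma$-strongly convex on $\mathbb{R}^n$ for some $\gamma>0$; (A2) for every $x$, $\|\nabla_x l(x,z)-\nabla_x l(x,z')\|\le\beta_z\|z-z'\|$ for all $z,z'\in\mathcal{Z}$, and for every $z\in\mathcal{Z}$, $\|\nabla_x l(x,z)-\nabla_x l(y,z)\|\le\beta_x\|x-y\|$ for all $x,y\in\mathbb{R}^n$; (A3) $W_1(\mathcal{D}(x),\mathcal{D}(y))\le\epsilon\|x-y\|$ and $W_1(\mathcal{D}_g(x),\mathcal{D}_g(y))\le\epsilon_g\|x-y\|$ for all $x,y\in\mathbb{R}^n$; (A4) $G$ has full row rank. Let $L_{x^*}:=\sqrt{\frac{\beta_x}{\gamma\,\lambda_{\min}(GG^{\mathrm T})}}$. If $L_{x^*}\epsilon_g<1$, then the problem $\min_x f_x(x)$ s.t. $Gx\le\xi(x)$ admits a unique constrained equilibrium point $x_s$, and for every initial point $x_0$ the sequence generated by Repeated Constrained Minimization converges to $x_s$ at a linear rate.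
   Context: Let $G\in\mathbb{R}^{d_w\times n}$ and let $l:\mathbb{R}^n\times\mathbb{R}^{d_z}\to\mathbb{R}$ be twice continuously differentiable. Let $\mathcal{Z}\subseteq\mathbb{R}^{d_z}$, $\mathcal{W}\subseteq\mathbb{R}^{d_w}$, and let $\mathcal{D},\mathcal{D}_g$ be maps assigning to each $x\in\mathbb{R}^n$ probability distributions $\mathcal{D}(x)$ on $\mathcal{Z}$ and $\mathcal{D}_g(x)$ on $\mathcal{W}$ (with measurability so that all expectations are well defined). For $x,x'\in\mathbb{R}^n$ put $f_{x'}(x)=\mathbb{E}_{z\sim\mathcal{D}(x')}[l(x,z)]$ and $\xi(x')=\mathbb{E}_{w\sim\mathcal{D}_g(x')}[w]\in\mathbb{R}^{d_w}$; inequalities between vectors are componentwise. A constrained equilibrium point is a vector $x_s$ such that $x_s=\arg\min_x\{f_{x_s}(x): Gx\le\xi(x_s)\}$. Repeated Constrained Minimization (RCM) starts from $x_0$ and iterates $x_{t+1}=\arg\min_x\{f_{x_t}(x): Gx\le\xi(x_t)\}$ for $t=0,1,2,\dots$. $W_1$ denotes the 1-Wasserstein (earth mover's) distance, $\|\cdot\|$ the Euclidean norm, and $\lambda_{\min}$ the smallest eigenvalue. The condition $\epsilon=0$ means the distribution in the objective does not depend on the decision. *)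

theory Defs
  imports "HOL-Analysis.Analysis" "HOL-Probability.Probability"
begin

text \<open>gamma-strong convexity of a real function on a set S (standard definition).\<close>
definition strongly_convex_on :: "'a::real_normed_vector set \<Rightarrow> real \<Rightarrow> ('a \<Rightarrow> real) \<Rightarrow> bool" where
  "strongly_convex_on S \<gamma> f \<longleftrightarrow> convex S \<and>
     (\<forall>x\<in>S. \<forall>y\<in>S. \<forall>t\<in>{0..1}.
        f ((1 - t) *\<^sub>R x + t *\<^sub>R y) \<le> (1 - t) * f x + t * f y - \<gamma> / 2 * t * (1 - t) * (norm (x - y))\<^sup>2)"

text \<open>Twice continuously differentiable on the whole space (C^2): the Frechet derivative
  exists everywhere and is itself everywhere Frechet differentiable with continuous derivative.\<close>
definition twice_cont_diff :: "('a::real_normed_vector \<Rightarrow> real) \<Rightarrow> bool" where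
  "twice_cont_diff f \<longleftrightarrow>
     (\<exists>(f' :: 'a \<Rightarrow> 'a \<Rightarrow>\<^sub>L real) (f'' :: 'a \<Rightarrow> 'a \<Rightarrow>\<^sub>L ('a \<Rightarrow>\<^sub>L real)).
        (\<forall>p. (f has_derivative blinfun_apply (f' p)) (at p)) \<and>
        (\<forall>p. (f' has_derivative blinfun_apply (f'' p)) (at p)) \<and>
        continuous_on UNIV f'')"

text \<open>Couplings of two probability measures on (the Borel sets of) a Euclidean space.\<close>
definition couplings :: "'a::euclidean_space measure \<Rightarrow> 'a measure \<Rightarrow> ('a \<times> 'a) measure set" where
  "couplings \<mu> \<nu> = {\<pi>. sets \<pi> = sets borel \<and> prob_space \<pi> \<and>
                        distr \<pi> borel fst = \<mu> \<and> distr \<pi> borel snd = \<nu>}"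

text \<open>1-Wasserstein (earth mover's) distance, valued in [0, \<infinity>].\<close>
definition W1 :: "'a::euclidean_space measure \<Rightarrow> 'a measure \<Rightarrow> ennreal" where
  "W1 \<mu> \<nu> = (INF \<pi>\<in>couplings \<mu> \<nu>. \<integral>\<^sup>+ p. ennreal (dist (fst p) (snd p)) \<partial>\<pi>)"

text \<open>Smallest eigenvalue of a (real square) matrix.\<close>
definition lambda_min :: "real^'n^'n \<Rightarrow> real" where
  "lambda_min A = Min {e. \<exists>v. v \<noteq> 0 \<and> A *v v = e *\<^sub>R v}"

text \<open>f_{x'}(x) = E_{z ~ D(x')} l(x,z)\<close>
definition obj :: "('x \<Rightarrow> 'z measure) \<Rightarrow> ('x \<Rightarrow> 'z \<Rightarrow> real) \<Rightarrow> 'x \<Rightarrow> 'x \<Rightarrow> real" where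
  "obj D l x' x = (\<integral>z. l x z \<partial>(D x'))"

text \<open>xi(x') = E_{w ~ D_g(x')} w\<close>
definition xi :: "('x \<Rightarrow> 'w::{banach, second_countable_topology} measure) \<Rightarrow> 'x \<Rightarrow> 'w" where
  "xi Dg x' = (\<integral>w. w \<partial>(Dg x'))"

text \<open>Constrained equilibrium point: x_s = argmin { f_{x_s}(x) : G x \<le> xi(x_s) }.\<close>
definition constrained_equilibrium ::
  "((real^'n) \<Rightarrow> 'z measure) \<Rightarrow> ((real^'n) \<Rightarrow> 'z \<Rightarrow> real) \<Rightarrow> real^'n^'m
     \<Rightarrow> ((real^'n) \<Rightarrow> (real^'m) measure) \<Rightarrow> real^'n \<Rightarrow> bool" where
  "constrained_equilibrium D l G Dg xs \<longleftrightarrow>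
     xs = arg_min (obj D l xs) (\<lambda>x. G *v x \<le> xi Dg xs)"

text \<open>Repeated Constrained Minimization iterates.\<close>
primrec RCM :: "((real^'n) \<Rightarrow> 'z measure) \<Rightarrow> ((real^'n) \<Rightarrow> 'z \<Rightarrow> real) \<Rightarrow> real^'n^'m
     \<Rightarrow> ((real^'n) \<Rightarrow> (real^'m) measure) \<Rightarrow> real^'n \<Rightarrow> nat \<Rightarrow> real^'n" where
  "RCM D l G Dg x0 0 = x0"
| "RCM D l G Dg x0 (Suc t) =
     (let xt = RCM D l G Dg x0 t in arg_min (obj D l xt) (\<lambda>x. G *v x \<le> xi Dg xt))"

end

theory Submission
  imports Defs
begin

text \<open>With \<open>\<epsilon> = 0\<close> all distributions \<open>D x\<close> are at Wasserstein distance zero, so by the easy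
  half of Kantorovich--Rubinstein duality the objectives \<open>f\<^sub>x\<close> differ only by additive
  constants and share their constrained minimisers with the single function \<open>F = f\<^sub>0\<close>. Averaging
  the pointwise bounds given by strong convexity and Lipschitz gradients squeezes \<open>F\<close> between
  two quadratics with the expected gradient as common slope, so that this slope is strongly
  monotone and co-coercive. RCM is then the iteration of \<open>T x = S (\<xi> x)\<close>, where \<open>S b\<close> minimises
  \<open>F\<close> over \<open>{y. G y \<le> b}\<close>. Choosing \<open>d\<close> with \<open>G d = b' - b\<close> and
  \<open>\<parallel>d\<parallel> \<le> \<parallel>b' - b\<parallel> / sqrt \<lambda>\<^sub>m\<^sub>i\<^sub>n(G G\<^sup>T)\<close>, the points \<open>S b' - d\<close> and \<open>S b + d\<close>
  are feasible for \<open>b\<close> and \<open>b'\<close>, and comparing the two variational inequalities gives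
  \<open>\<parallel>S b' - S b\<parallel> \<le> sqrt (\<beta>\<^sub>x / \<gamma>) \<parallel>d\<parallel>\<close>. As \<open>\<xi>\<close> is \<open>\<epsilon>\<^sub>g\<close>-Lipschitz by the same duality bound,
  \<open>T\<close> is a contraction with factor \<open>L\<^sub>x\<^sub>* \<epsilon>\<^sub>g < 1\<close>, and Banach's fixed point theorem gives the
  unique equilibrium and the linear rate.\<close>

section \<open>Quadratic bounds from strong convexity and Lipschitz gradients\<close>

lemma has_real_derivative_along_line:
  fixes f :: "'a::real_inner \<Rightarrow> real"
  assumes "GDERIV f (x + t *\<^sub>R v) :> g"
  shows "((\<lambda>s. f (x + s *\<^sub>R v)) has_real_derivative g \<bullet> v) (at t)"
proof -
  have "((\<lambda>s. x + s *\<^sub>R v) has_derivative (\<lambda>s. s *\<^sub>R v)) (at t)"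
    by (auto intro!: derivative_eq_intros)
  moreover have "(f has_derivative (\<lambda>h. h \<bullet> g)) (at (x + t *\<^sub>R v))"
    using assms by (simp add: gderiv_def)
  ultimately have "((\<lambda>s. f (x + s *\<^sub>R v)) has_derivative (\<lambda>s. (s *\<^sub>R v) \<bullet> g)) (at t)"
    by (rule has_derivative_compose)
  moreover have "(\<lambda>s. (s *\<^sub>R v) \<bullet> g) = (*) (g \<bullet> v)"
    by (auto simp: inner_commute)
  ultimately show ?thesis
    by (simp add: has_field_derivative_def)
qed

lemma lipschitz_gradient_upper_bound:
  fixes f :: "'a::real_inner \<Rightarrow> real"
  assumes grad: "\<And>x. GDERIV f x :> g x"
    and lip: "\<And>x y. norm (g x - g y) \<le> \<beta> * norm (x - y)"
  shows "f (y + v) \<le> f y + g y \<bullet> v + \<beta> / 2 * (norm v)\<^sup>2"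
proof -
  define \<phi> where "\<phi> t = f (y + t *\<^sub>R v) - t * (g y \<bullet> v) - \<beta> / 2 * t\<^sup>2 * (norm v)\<^sup>2" for t
  have \<phi>': "(\<phi> has_real_derivative (g (y + t *\<^sub>R v) \<bullet> v - g y \<bullet> v - \<beta> * t * (norm v)\<^sup>2)) (at t)"
    for t
    unfolding \<phi>_def
    by (rule has_real_derivative_along_line[OF grad] derivative_eq_intros refl | simp)+
  have "\<phi> 1 \<le> \<phi> 0"
  proof (rule DERIV_nonpos_imp_nonincreasing[of 0 1 \<phi>])
    fix t :: real
    assume t: "0 \<le> t" "t \<le> 1"
    have "g (y + t *\<^sub>R v) \<bullet> v - g y \<bullet> v = (g (y + t *\<^sub>R v) - g y) \<bullet> v"
      by (simp add: inner_diff_left)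
    also have "\<dots> \<le> norm (g (y + t *\<^sub>R v) - g y) * norm v"
      by (rule norm_cauchy_schwarz)
    also have "\<dots> \<le> \<beta> * norm (t *\<^sub>R v) * norm v"
      using lip[of "y + t *\<^sub>R v" y] by (simp add: mult_right_mono)
    also have "\<dots> = \<beta> * t * (norm v)\<^sup>2"
      using t by (simp add: power2_eq_square)
    finally show "\<exists>d. (\<phi> has_real_derivative d) (at t) \<and> d \<le> 0"
      using \<phi>' by force
  qed simp
  then show ?thesis
    by (simp add: \<phi>_def)
qed

lemma strongly_convex_on_gradient_lower_bound:
  fixes f :: "'a::real_inner \<Rightarrow> real"
  assumes grad: "GDERIV f y :> g" and convex: "strongly_convex_on UNIV \<gamma> f"
  shows "f y + g \<bullet> v + \<gamma> / 2 * (norm v)\<^sup>2 \<le> f (y + v)"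
proof -
  define \<phi> where "\<phi> s = f (y + s *\<^sub>R v)" for s
  have "(\<phi> has_real_derivative g \<bullet> v) (at 0 within {0<..})"
    unfolding \<phi>_def using has_real_derivative_along_line[of f y 0 v g] grad
    by (auto intro: has_field_derivative_at_within)
  then have quotient: "((\<lambda>s. (\<phi> s - \<phi> 0) / (s - 0)) \<longlongrightarrow> g \<bullet> v) (at_right 0)"
    by (simp add: has_field_derivative_iff)
  have bound: "((\<lambda>s. f (y + v) - f y - \<gamma> / 2 * (1 - s) * (norm v)\<^sup>2)
      \<longlongrightarrow> f (y + v) - f y - \<gamma> / 2 * (1 - 0) * (norm v)\<^sup>2) (at_right 0)"
    by (intro tendsto_intros)
  have "\<forall>\<^sub>F s in at_right 0. (\<phi> s - \<phi> 0) / (s - 0) \<le> f (y + v) - f y - \<gamma> / 2 * (1 - s) * (norm v)\<^sup>2"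
  proof (rule eventually_at_rightI[of 0 1])
    fix s :: real
    assume "s \<in> {0<..<1}"
    then have s: "0 < s" "s < 1" by auto
    have "f ((1 - s) *\<^sub>R y + s *\<^sub>R (y + v))
        \<le> (1 - s) * f y + s * f (y + v) - \<gamma> / 2 * s * (1 - s) * (norm (y - (y + v)))\<^sup>2"
      using convex s unfolding strongly_convex_on_def by (meson UNIV_I atLeastAtMost_iff less_imp_le)
    moreover have "(1 - s) *\<^sub>R y + s *\<^sub>R (y + v) = y + s *\<^sub>R v"
      by (simp add: algebra_simps)
    ultimately have "\<phi> s - \<phi> 0 \<le> s * (f (y + v) - f y - \<gamma> / 2 * (1 - s) * (norm v)\<^sup>2)"
      by (simp add: \<phi>_def algebra_simps)
    then show "(\<phi> s - \<phi> 0) / (s - 0) \<le> f (y + v) - f y - \<gamma> / 2 * (1 - s) * (norm v)\<^sup>2"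
      using s by (simp add: divide_le_eq mult.commute)
  qed simp
  then have "g \<bullet> v \<le> f (y + v) - f y - \<gamma> / 2 * (1 - 0) * (norm v)\<^sup>2"
    by (rule tendsto_le[OF trivial_limit_at_right_real bound quotient])
  then show ?thesis
    by simp
qed

lemma mixed_difference_le:
  fixes l :: "'a::real_inner \<Rightarrow> 'z \<Rightarrow> real"
  assumes grad: "\<And>x z. GDERIV (\<lambda>x. l x z) x :> gradl x z"
    and close: "\<And>x. norm (gradl x z - gradl x z') \<le> c"
  shows "\<bar>(l y z - l y' z) - (l y z' - l y' z')\<bar> \<le> c * norm (y - y')"
proof -
  define p where "p t = y' + t *\<^sub>R (y - y')" for t
  define \<psi> where "\<psi> t = l (p t) z - l (p t) z'" for t
  have "(\<psi> has_real_derivative (gradl (p t) z - gradl (p t) z') \<bullet> (y - y')) (at t)" for t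
    unfolding \<psi>_def p_def inner_diff_left
    by (intro DERIV_diff has_real_derivative_along_line grad)
  then obtain t where "\<psi> 1 - \<psi> 0 = (1 - 0) * ((gradl (p t) z - gradl (p t) z') \<bullet> (y - y'))"
    using MVT2[of 0 1 \<psi>] by force
  then have "\<bar>\<psi> 1 - \<psi> 0\<bar> \<le> norm (gradl (p t) z - gradl (p t) z') * norm (y - y')"
    by (simp add: Cauchy_Schwarz_ineq2)
  also have "\<dots> \<le> c * norm (y - y')"
    by (intro mult_right_mono close) simp
  finally show ?thesis
    by (simp add: \<psi>_def p_def algebra_simps)
qed

lemma nonneg_if_nonneg_plus_small_multiple:
  fixes a b :: real
  assumes "\<And>t. 0 < t \<Longrightarrow> t < 1 \<Longrightarrow> 0 \<le> a + b * t"
  shows "0 \<le> a"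
proof -
  have "((\<lambda>t. a + b * t) \<longlongrightarrow> a + b * 0) (at_right 0)"
    by (intro tendsto_intros)
  moreover have "\<forall>\<^sub>F t in at_right 0. 0 \<le> a + b * t"
    using assms by (intro eventually_at_rightI[of 0 1]) auto
  ultimately show ?thesis
    by (simp add: tendsto_lowerbound)
qed

section \<open>Wasserstein distance and expectations\<close>

lemma coupling_integral_diff_le:
  fixes g :: "'a::euclidean_space \<Rightarrow> 'b::{banach, second_countable_topology}"
  assumes coupling: "\<pi> \<in> couplings \<mu> \<nu>"
    and int_\<mu>: "integrable \<mu> g" and int_\<nu>: "integrable \<nu> g"
    and supp_\<mu>: "AE z in \<mu>. z \<in> Z" and supp_\<nu>: "AE z in \<nu>. z \<in> Z"
    and "0 \<le> c" and lip: "\<And>z z'. z \<in> Z \<Longrightarrow> z' \<in> Z \<Longrightarrow> norm (g z - g z') \<le> c * dist z z'"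
  shows "ennreal (norm ((\<integral>z. g z \<partial>\<mu>) - (\<integral>z. g z \<partial>\<nu>)))
    \<le> ennreal c * (\<integral>\<^sup>+p. ennreal (dist (fst p) (snd p)) \<partial>\<pi>)"
proof -
  have sets_\<pi>: "sets \<pi> = sets borel" and \<mu>: "\<mu> = distr \<pi> borel fst" and \<nu>: "\<nu> = distr \<pi> borel snd"
    using coupling unfolding couplings_def by auto
  have [measurable]: "fst \<in> measurable \<pi> borel" "snd \<in> measurable \<pi> borel"
    "(\<lambda>p. dist (fst p) (snd p)) \<in> borel_measurable \<pi>"
    by (auto simp: measurable_cong_sets[OF sets_\<pi> refl] intro!: borel_measurable_continuous_onI continuous_intros)
  have [measurable]: "g \<in> borel_measurable borel"
    using borel_measurable_integrable[OF int_\<mu>] \<mu> by simp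
  have int_fst: "integrable \<pi> (\<lambda>p. g (fst p))" and int_snd: "integrable \<pi> (\<lambda>p. g (snd p))"
    using int_\<mu> int_\<nu> unfolding \<mu> \<nu> by (simp_all add: integrable_distr_eq)
  have "(\<integral>z. g z \<partial>\<mu>) - (\<integral>z. g z \<partial>\<nu>) = (\<integral>p. g (fst p) - g (snd p) \<partial>\<pi>)"
    using int_fst int_snd unfolding \<mu> \<nu> by (simp add: integral_distr)
  then have "ennreal (norm ((\<integral>z. g z \<partial>\<mu>) - (\<integral>z. g z \<partial>\<nu>)))
      \<le> (\<integral>\<^sup>+p. norm (g (fst p) - g (snd p)) \<partial>\<pi>)"
    using int_fst int_snd by (simp only:) (intro integral_norm_bound_ennreal Bochner_Integration.integrable_diff)
  also have "\<dots> \<le> (\<integral>\<^sup>+p. ennreal c * ennreal (dist (fst p) (snd p)) \<partial>\<pi>)"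
  proof (rule nn_integral_mono_AE)
    have "AE p in \<pi>. fst p \<in> Z" "AE p in \<pi>. snd p \<in> Z"
      using supp_\<mu> supp_\<nu> unfolding \<mu> \<nu> by (auto elim: AE_distrD[rotated])
    then show "AE p in \<pi>. ennreal (norm (g (fst p) - g (snd p)))
        \<le> ennreal c * ennreal (dist (fst p) (snd p))"
      by eventually_elim (simp add: lip \<open>0 \<le> c\<close> ennreal_mult[symmetric] ennreal_leI)
  qed
  also have "\<dots> = ennreal c * (\<integral>\<^sup>+p. ennreal (dist (fst p) (snd p)) \<partial>\<pi>)"
    by (simp add: nn_integral_cmult)
  finally show ?thesis .
qed

lemma W1_integral_diff_le:
  fixes g :: "'a::euclidean_space \<Rightarrow> 'b::{banach, second_countable_topology}"
  assumes int_\<mu>: "integrable \<mu> g" and int_\<nu>: "integrable \<nu> g"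
    and supp_\<mu>: "AE z in \<mu>. z \<in> Z" and supp_\<nu>: "AE z in \<nu>. z \<in> Z"
    and "0 < c" and lip: "\<And>z z'. z \<in> Z \<Longrightarrow> z' \<in> Z \<Longrightarrow> norm (g z - g z') \<le> c * dist z z'"
  shows "ennreal (norm ((\<integral>z. g z \<partial>\<mu>) - (\<integral>z. g z \<partial>\<nu>))) \<le> ennreal c * W1 \<mu> \<nu>"
proof -
  define a where "a = norm ((\<integral>z. g z \<partial>\<mu>) - (\<integral>z. g z \<partial>\<nu>)) / c"
  have a: "ennreal (norm ((\<integral>z. g z \<partial>\<mu>) - (\<integral>z. g z \<partial>\<nu>))) = ennreal c * ennreal a"
    using \<open>0 < c\<close> by (simp add: a_def ennreal_mult[symmetric])
  have "ennreal a \<le> (\<integral>\<^sup>+p. ennreal (dist (fst p) (snd p)) \<partial>\<pi>)" if "\<pi> \<in> couplings \<mu> \<nu>" for \<pi>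
    using coupling_integral_diff_le[OF that int_\<mu> int_\<nu> supp_\<mu> supp_\<nu> _ lip] \<open>0 < c\<close>
    by (simp add: a ennreal_mult_le_mult_iff)
  then have "ennreal a \<le> W1 \<mu> \<nu>"
    unfolding W1_def by (rule INF_greatest)
  then show ?thesis
    unfolding a by (rule mult_left_mono) simp
qed

lemma integral_eq_if_W1_zero:
  fixes g :: "'a::euclidean_space \<Rightarrow> real"
  assumes "W1 \<mu> \<nu> = 0" and "integrable \<mu> g" and "integrable \<nu> g"
    and "AE z in \<mu>. z \<in> Z" and "AE z in \<nu>. z \<in> Z"
    and lip: "\<And>z z'. z \<in> Z \<Longrightarrow> z' \<in> Z \<Longrightarrow> norm (g z - g z') \<le> c * dist z z'"
  shows "(\<integral>z. g z \<partial>\<mu>) = (\<integral>z. g z \<partial>\<nu>)"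
proof -
  have "norm (g z - g z') \<le> (max c 0 + 1) * dist z z'" if "z \<in> Z" "z' \<in> Z" for z z'
  proof -
    have "c * dist z z' \<le> (max c 0 + 1) * dist z z'"
      by (intro mult_right_mono) auto
    then show ?thesis
      using lip[OF that] by linarith
  qed
  then have "ennreal (norm ((\<integral>z. g z \<partial>\<mu>) - (\<integral>z. g z \<partial>\<nu>))) \<le> ennreal (max c 0 + 1) * W1 \<mu> \<nu>"
    using assms by (intro W1_integral_diff_le) auto
  then show ?thesis
    using \<open>W1 \<mu> \<nu> = 0\<close> by simp
qed

lemma xi_lipschitz:
  fixes Dg :: "'x::real_normed_vector \<Rightarrow> 'w::euclidean_space measure"
  assumes int: "\<And>x. integrable (Dg x) (\<lambda>w. w)"
    and W1_le: "\<And>x y. W1 (Dg x) (Dg y) \<le> ennreal (\<epsilon> * norm (x - y))"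
  shows "norm (xi Dg x - xi Dg y) \<le> max \<epsilon> 0 * norm (x - y)"
proof -
  have "ennreal (norm (xi Dg x - xi Dg y)) \<le> ennreal 1 * W1 (Dg x) (Dg y)"
    unfolding xi_def by (rule W1_integral_diff_le[OF int int, where Z = UNIV]) (auto simp: dist_norm)
  also have "\<dots> \<le> ennreal (max \<epsilon> 0 * norm (x - y))"
  proof -
    have "\<epsilon> * norm (x - y) \<le> max \<epsilon> 0 * norm (x - y)"
      by (intro mult_right_mono) auto
    then show ?thesis
      using W1_le[of x y] by (simp add: order_trans[OF _ ennreal_leI])
  qed
  finally show ?thesis
    by (simp add: ennreal_le_iff)
qed

lemma inner_gradient_borel_measurable:
  fixes l :: "'a::real_inner \<Rightarrow> 'z \<Rightarrow> real"
  assumes grad: "\<And>x z. GDERIV (\<lambda>x. l x z) x :> gradl x z"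
    and meas: "\<And>x. (\<lambda>z. l x z) \<in> borel_measurable \<mu>"
  shows "(\<lambda>z. gradl y z \<bullet> v) \<in> borel_measurable \<mu>"
proof (rule borel_measurable_LIMSEQ_real)
  fix z
  have "((\<lambda>s. l (y + s *\<^sub>R v) z) has_real_derivative gradl y z \<bullet> v) (at 0)"
    using has_real_derivative_along_line[of "\<lambda>x. l x z" y 0 v] grad by simp
  then have "((\<lambda>s. (l (y + s *\<^sub>R v) z - l y z) / s) \<longlongrightarrow> gradl y z \<bullet> v) (at 0)"
    by (simp add: has_field_derivative_iff)
  moreover have "filterlim (\<lambda>i. inverse (real (Suc i))) (at 0) sequentially"
    unfolding filterlim_at using LIMSEQ_inverse_real_of_nat by auto
  ultimately show "(\<lambda>i. (l (y + inverse (real (Suc i)) *\<^sub>R v) z - l y z) / inverse (real (Suc i)))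
      \<longlonglongrightarrow> gradl y z \<bullet> v"
    by (rule filterlim_compose)
qed (use meas in measurable)

lemma
  fixes l :: "'a::euclidean_space \<Rightarrow> 'z \<Rightarrow> real"
  assumes "finite_measure \<mu>"
    and grad: "\<And>x z. GDERIV (\<lambda>x. l x z) x :> gradl x z"
    and int: "\<And>x. integrable \<mu> (\<lambda>z. l x z)"
    and supp: "AE z in \<mu>. z \<in> Z"
    and lower: "\<And>z y v. z \<in> Z \<Longrightarrow> l y z + gradl y z \<bullet> v + \<gamma> / 2 * (norm v)\<^sup>2 \<le> l (y + v) z"
    and upper: "\<And>z y v. z \<in> Z \<Longrightarrow> l (y + v) z \<le> l y z + gradl y z \<bullet> v + \<beta> / 2 * (norm v)\<^sup>2"
  shows integrable_inner_gradient: "integrable \<mu> (\<lambda>z. gradl y z \<bullet> v)"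
    and integrable_gradient: "integrable \<mu> (gradl y)"
proof -
  interpret finite_measure \<mu> by fact
  define C where "C v = (\<bar>\<beta>\<bar> + \<bar>\<gamma>\<bar>) * (norm v)\<^sup>2" for v :: 'a
  have C: "\<gamma> / 2 * (norm v)\<^sup>2 \<ge> - C v" "\<beta> / 2 * (norm v)\<^sup>2 \<le> C v" for v
  proof -
    have "0 \<le> (\<gamma> / 2 + (\<bar>\<beta>\<bar> + \<bar>\<gamma>\<bar>)) * (norm v)\<^sup>2" "0 \<le> (\<bar>\<beta>\<bar> + \<bar>\<gamma>\<bar> - \<beta> / 2) * (norm v)\<^sup>2"
      by (intro mult_nonneg_nonneg; simp)+
    then show "\<gamma> / 2 * (norm v)\<^sup>2 \<ge> - C v" "\<beta> / 2 * (norm v)\<^sup>2 \<le> C v"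
      by (simp_all add: C_def ring_distribs)
  qed
  show inner: "integrable \<mu> (\<lambda>z. gradl y z \<bullet> v)" for y v
  proof (rule Bochner_Integration.integrable_bound)
    show "integrable \<mu> (\<lambda>z. \<bar>l (y + v) z - l y z\<bar> + C v)"
      using int by auto
    show "(\<lambda>z. gradl y z \<bullet> v) \<in> borel_measurable \<mu>"
      using int by (intro inner_gradient_borel_measurable[OF grad] borel_measurable_integrable)
    show "AE z in \<mu>. norm (gradl y z \<bullet> v) \<le> norm (\<bar>l (y + v) z - l y z\<bar> + C v)"
      using supp
    proof eventually_elim
      case (elim z)
      show ?case
        using lower[OF elim, of y v] upper[OF elim, of y v] C[of v] by (auto simp: C_def)
    qed
  qed
  have "integrable \<mu> (\<lambda>z. \<Sum>b\<in>Basis. (gradl y z \<bullet> b) *\<^sub>R b)"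
    using inner by auto
  then show "integrable \<mu> (gradl y)"
    by (simp add: euclidean_representation)
qed

lemma
  fixes l :: "'a::euclidean_space \<Rightarrow> 'z \<Rightarrow> real"
  assumes "prob_space \<mu>"
    and grad: "\<And>x z. GDERIV (\<lambda>x. l x z) x :> gradl x z"
    and int: "\<And>x. integrable \<mu> (\<lambda>z. l x z)"
    and supp: "AE z in \<mu>. z \<in> Z"
    and lower: "\<And>z y v. z \<in> Z \<Longrightarrow> l y z + gradl y z \<bullet> v + \<gamma> / 2 * (norm v)\<^sup>2 \<le> l (y + v) z"
    and upper: "\<And>z y v. z \<in> Z \<Longrightarrow> l (y + v) z \<le> l y z + gradl y z \<bullet> v + \<beta> / 2 * (norm v)\<^sup>2"
  shows expectation_lower_bound:
      "(\<integral>z. l y z \<partial>\<mu>) + (\<integral>z. gradl y z \<partial>\<mu>) \<bullet> v + \<gamma> / 2 * (norm v)\<^sup>2 \<le> (\<integral>z. l (y + v) z \<partial>\<mu>)"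
    and expectation_upper_bound:
      "(\<integral>z. l (y + v) z \<partial>\<mu>) \<le> (\<integral>z. l y z \<partial>\<mu>) + (\<integral>z. gradl y z \<partial>\<mu>) \<bullet> v + \<beta> / 2 * (norm v)\<^sup>2"
proof -
  interpret prob_space \<mu> by fact
  note integrable = integrable_inner_gradient[OF finite_measure_axioms grad int supp lower upper]
    integrable_gradient[OF finite_measure_axioms grad int supp lower upper]
  have "(\<integral>z. l y z \<partial>\<mu>) + (\<integral>z. gradl y z \<partial>\<mu>) \<bullet> v + \<gamma> / 2 * (norm v)\<^sup>2
      = (\<integral>z. l y z + gradl y z \<bullet> v + \<gamma> / 2 * (norm v)\<^sup>2 \<partial>\<mu>)"
    using int integrable by (simp add: prob_space)
  also have "\<dots> \<le> (\<integral>z. l (y + v) z \<partial>\<mu>)"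
    using int integrable supp lower by (intro integral_mono_AE) auto
  finally show "(\<integral>z. l y z \<partial>\<mu>) + (\<integral>z. gradl y z \<partial>\<mu>) \<bullet> v + \<gamma> / 2 * (norm v)\<^sup>2
      \<le> (\<integral>z. l (y + v) z \<partial>\<mu>)" .
  have "(\<integral>z. l (y + v) z \<partial>\<mu>) \<le> (\<integral>z. l y z + gradl y z \<bullet> v + \<beta> / 2 * (norm v)\<^sup>2 \<partial>\<mu>)"
    using int integrable supp upper by (intro integral_mono_AE) auto
  also have "\<dots> = (\<integral>z. l y z \<partial>\<mu>) + (\<integral>z. gradl y z \<partial>\<mu>) \<bullet> v + \<beta> / 2 * (norm v)\<^sup>2"
    using int integrable by (simp add: prob_space)
  finally show "(\<integral>z. l (y + v) z \<partial>\<mu>)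
      \<le> (\<integral>z. l y z \<partial>\<mu>) + (\<integral>z. gradl y z \<partial>\<mu>) \<bullet> v + \<beta> / 2 * (norm v)\<^sup>2" .
qed

section \<open>Functions between two quadratics\<close>

text \<open>\<open>\<Gamma>\<close> is not required to be the gradient of \<open>F\<close>: the two quadratic bounds are all that
  survives averaging \<open>l\<close> over a distribution.\<close>

locale smooth_strongly_convex =
  fixes F :: "'a::euclidean_space \<Rightarrow> real" and \<Gamma> :: "'a \<Rightarrow> 'a" and \<gamma> \<beta> :: real
  assumes lower_bound: "\<And>y v. F y + \<Gamma> y \<bullet> v + \<gamma> / 2 * (norm v)\<^sup>2 \<le> F (y + v)"
    and upper_bound: "\<And>y v. F (y + v) \<le> F y + \<Gamma> y \<bullet> v + \<beta> / 2 * (norm v)\<^sup>2"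
    and gamma_pos: "0 < \<gamma>"
begin

lemma gamma_le_beta: "\<gamma> \<le> \<beta>"
proof -
  obtain b :: 'a where "b \<in> Basis"
    using nonempty_Basis by blast
  then show ?thesis
    using lower_bound[of 0 b] upper_bound[of 0 b] by simp
qed

lemma beta_pos: "0 < \<beta>"
  using gamma_pos gamma_le_beta by linarith

lemma lower_bound_at: "F y + \<Gamma> y \<bullet> (u - y) + \<gamma> / 2 * (norm (u - y))\<^sup>2 \<le> F u"
  using lower_bound[of y "u - y"] by simp

lemma upper_bound_at: "F u \<le> F y + \<Gamma> y \<bullet> (u - y) + \<beta> / 2 * (norm (u - y))\<^sup>2"
  using upper_bound[of y "u - y"] by simp

lemma gradient_inequality: "F y + \<Gamma> y \<bullet> (u - y) \<le> F u"
proof -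
  have "0 \<le> \<gamma> / 2 * (norm (u - y))\<^sup>2"
    using gamma_pos by simp
  then show ?thesis
    using lower_bound_at[of y u] by linarith
qed

lemma convex_on_F: "convex_on UNIV F"
proof (rule convex_onI)
  fix t :: real and a b :: 'a
  assume t: "0 < t" "t < 1"
  define w where "w = (1 - t) *\<^sub>R a + t *\<^sub>R b"
  have "(1 - t) * (\<Gamma> w \<bullet> (a - w)) + t * (\<Gamma> w \<bullet> (b - w)) = \<Gamma> w \<bullet> ((1 - t) *\<^sub>R (a - w) + t *\<^sub>R (b - w))"
    by (simp add: inner_add_right)
  also have "\<dots> = 0"
    by (simp add: w_def algebra_simps)
  finally have "(1 - t) * (\<Gamma> w \<bullet> (a - w)) + t * (\<Gamma> w \<bullet> (b - w)) = 0" .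
  moreover have "(1 - t) * (F w + \<Gamma> w \<bullet> (a - w)) + t * (F w + \<Gamma> w \<bullet> (b - w)) \<le> (1 - t) * F a + t * F b"
    using t gradient_inequality by (intro add_mono mult_left_mono) auto
  ultimately show "F ((1 - t) *\<^sub>R a + t *\<^sub>R b) \<le> (1 - t) * F a + t * F b"
    unfolding w_def[symmetric] by (simp add: algebra_simps)
qed simp

lemma continuous_on_F: "continuous_on UNIV F"
  by (rule convex_on_continuous[OF open_UNIV convex_on_F])

lemma cocoercive: "(norm (\<Gamma> y - \<Gamma> x))\<^sup>2 \<le> \<beta> * ((\<Gamma> y - \<Gamma> x) \<bullet> (y - x))"
proof -
  \<comment> \<open>the descent lemma for \<open>F - \<Gamma> x \<bullet> (\<cdot>)\<close>, which is minimal at \<open>x\<close>\<close>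
  have descent: "F x + \<Gamma> x \<bullet> (y - x) + (norm (\<Gamma> y - \<Gamma> x))\<^sup>2 / (2 * \<beta>) \<le> F y" for x y
  proof -
    define g where "g = \<Gamma> y - \<Gamma> x"
    define w where "w = y - (1 / \<beta>) *\<^sub>R g"
    have "F x + \<Gamma> x \<bullet> (w - x) \<le> F w"
      by (rule gradient_inequality)
    moreover have "F w \<le> F y + \<Gamma> y \<bullet> (w - y) + \<beta> / 2 * (norm (w - y))\<^sup>2"
      by (rule upper_bound_at)
    moreover have "\<Gamma> x \<bullet> (w - x) = \<Gamma> x \<bullet> (y - x) - \<Gamma> x \<bullet> g / \<beta>"
      by (simp add: w_def inner_diff_right algebra_simps)
    moreover have "\<Gamma> y \<bullet> (w - y) = - (\<Gamma> y \<bullet> g) / \<beta>"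
      by (simp add: w_def)
    moreover have "\<beta> / 2 * (norm (w - y))\<^sup>2 = (norm g)\<^sup>2 / (2 * \<beta>)"
      using beta_pos by (simp add: w_def power2_eq_square field_simps)
    moreover have "\<Gamma> y \<bullet> g / \<beta> - \<Gamma> x \<bullet> g / \<beta> = 2 * ((norm g)\<^sup>2 / (2 * \<beta>))"
      using beta_pos by (simp add: g_def power2_norm_eq_inner inner_diff_left field_simps)
    ultimately show ?thesis
      unfolding g_def[symmetric] by linarith
  qed
  have "norm (\<Gamma> x - \<Gamma> y) = norm (\<Gamma> y - \<Gamma> x)" "\<Gamma> y \<bullet> (x - y) = - (\<Gamma> y \<bullet> (y - x))"
    by (simp_all add: norm_minus_commute inner_diff_right)
  then have "(norm (\<Gamma> y - \<Gamma> x))\<^sup>2 / \<beta> \<le> (\<Gamma> y - \<Gamma> x) \<bullet> (y - x)"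
    using descent[of x y] descent[of y x] by (simp add: inner_diff_left)
  then show ?thesis
    using beta_pos by (simp add: divide_le_eq mult.commute)
qed

lemma strongly_monotone: "\<gamma> * (norm (y - x))\<^sup>2 \<le> (\<Gamma> y - \<Gamma> x) \<bullet> (y - x)"
proof -
  have "norm (x - y) = norm (y - x)" "\<Gamma> y \<bullet> (x - y) = - (\<Gamma> y \<bullet> (y - x))"
    by (simp_all add: norm_minus_commute inner_diff_right)
  then show ?thesis
    using lower_bound_at[of x y] lower_bound_at[of y x] by (simp add: inner_diff_left)
qed


lemma less_F_outside_cball:
  assumes far: "2 * norm (\<Gamma> y) / \<gamma> < norm (u - y)"
  shows "F y < F u"
proof -
  define r where "r = norm (u - y)"
  have "- (norm (\<Gamma> y) * r) \<le> \<Gamma> y \<bullet> (u - y)"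
    unfolding r_def using Cauchy_Schwarz_ineq2[of "\<Gamma> y" "u - y"] by linarith
  moreover have "norm (\<Gamma> y) * r < \<gamma> / 2 * r\<^sup>2"
  proof -
    have "2 * norm (\<Gamma> y) < \<gamma> * r" "0 < r"
      using far gamma_pos by (auto simp: r_def divide_less_eq mult.commute intro: le_less_trans)
    then have "norm (\<Gamma> y) * r < (\<gamma> * r / 2) * r"
      by (intro mult_strict_right_mono) auto
    then show ?thesis
      by (simp add: power2_eq_square algebra_simps)
  qed
  ultimately show ?thesis
    using lower_bound_at[of y u] unfolding r_def by linarith
qed

lemma exists_minimizer:
  assumes "closed K" and "K \<noteq> {}"
  shows "\<exists>x\<in>K. \<forall>u\<in>K. F x \<le> F u"
proof -
  obtain y where y: "y \<in> K"
    using assms(2) by auto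
  define R where "R = 2 * norm (\<Gamma> y) / \<gamma>"
  have "y \<in> K \<inter> cball y R"
    using y gamma_pos by (simp add: R_def)
  moreover have "compact (K \<inter> cball y R)"
    using assms(1) by (intro closed_Int_compact compact_cball)
  ultimately obtain x where x: "x \<in> K \<inter> cball y R" and min: "\<forall>u\<in>K \<inter> cball y R. F x \<le> F u"
    using continuous_attains_inf[OF _ _ continuous_on_subset[OF continuous_on_F subset_UNIV]] by blast
  have "F x \<le> F u" if "u \<in> K" for u
  proof (cases "u \<in> cball y R")
    case True
    then show ?thesis
      using min that by blast
  next
    case False
    then have "F y < F u"
      by (intro less_F_outside_cball) (simp add: R_def dist_norm norm_minus_commute)
    moreover have "F x \<le> F y"
      using min \<open>y \<in> K \<inter> cball y R\<close> by blast
    ultimately show ?thesis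
      by linarith
  qed
  then show ?thesis
    using x by blast
qed

lemma minimizer_variational_inequality:
  assumes "convex K" and "x \<in> K" and min: "\<forall>u\<in>K. F x \<le> F u" and "u \<in> K"
  shows "0 \<le> \<Gamma> x \<bullet> (u - x)"
proof (rule nonneg_if_nonneg_plus_small_multiple)
  fix t :: real
  assume t: "0 < t" "t < 1"
  have "x + t *\<^sub>R (u - x) = (1 - t) *\<^sub>R x + t *\<^sub>R u"
    by (simp add: algebra_simps)
  also have "\<dots> \<in> K"
    using assms t by (intro convexD) auto
  finally have "F x \<le> F (x + t *\<^sub>R (u - x))"
    using min by blast
  also have "\<dots> \<le> F x + t * (\<Gamma> x \<bullet> (u - x)) + \<beta> / 2 * t\<^sup>2 * (norm (u - x))\<^sup>2"
    using upper_bound[of x "t *\<^sub>R (u - x)"] t by (simp add: power_mult_distrib)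
  finally have "0 \<le> t * (\<Gamma> x \<bullet> (u - x) + \<beta> / 2 * (norm (u - x))\<^sup>2 * t)"
    by (simp add: power2_eq_square algebra_simps)
  then show "0 \<le> \<Gamma> x \<bullet> (u - x) + \<beta> / 2 * (norm (u - x))\<^sup>2 * t"
    using t by (simp add: zero_le_mult_iff)
qed

lemma
  assumes "closed K" and "convex K" and "K \<noteq> {}"
  shows arg_min_in: "arg_min F (\<lambda>y. y \<in> K) \<in> K"
    and arg_min_variational_inequality:
      "u \<in> K \<Longrightarrow> 0 \<le> \<Gamma> (arg_min F (\<lambda>y. y \<in> K)) \<bullet> (u - arg_min F (\<lambda>y. y \<in> K))"
proof -
  let ?Q = "\<lambda>x. x \<in> K \<and> (\<forall>u\<in>K. 0 \<le> \<Gamma> x \<bullet> (u - x))"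
  obtain x0 where "x0 \<in> K" "\<forall>u\<in>K. F x0 \<le> F u"
    using exists_minimizer[OF assms(1,3)] by blast
  then have "?Q (arg_min F (\<lambda>y. y \<in> K))"
    using arg_minI[where P = "\<lambda>y. y \<in> K" and f = F and Q = ?Q and x = x0]
    by (auto simp: not_less intro: minimizer_variational_inequality[OF assms(2)])
  then show "arg_min F (\<lambda>y. y \<in> K) \<in> K"
    and "u \<in> K \<Longrightarrow> 0 \<le> \<Gamma> (arg_min F (\<lambda>y. y \<in> K)) \<bullet> (u - arg_min F (\<lambda>y. y \<in> K))"
    by blast+
qed

lemma variational_solutions_close:
  assumes vi: "\<forall>u\<in>K. 0 \<le> \<Gamma> x \<bullet> (u - x)" and vi': "\<forall>u\<in>K'. 0 \<le> \<Gamma> x' \<bullet> (u - x')"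
    and "x' - d \<in> K" and "x + d \<in> K'"
  shows "norm (x' - x) \<le> sqrt (\<beta> / \<gamma>) * norm d"
proof -
  define e where "e = x' - x"
  define g where "g = \<Gamma> x' - \<Gamma> x"
  have "0 \<le> \<Gamma> x \<bullet> (e - d)" "0 \<le> \<Gamma> x' \<bullet> (d - e)"
    using vi vi' assms(3,4) by (metis e_def diff_diff_eq2 add_diff_eq diff_diff_eq add.commute)+
  then have "g \<bullet> e \<le> g \<bullet> d"
    by (simp add: g_def inner_diff_left inner_diff_right)
  also have "\<dots> \<le> norm g * norm d"
    by (rule norm_cauchy_schwarz)
  finally have ge: "g \<bullet> e \<le> norm g * norm d" .
  have "norm g * norm g \<le> norm g * (\<beta> * norm d)"
    using cocoercive[of x' x] mult_left_mono[OF ge, of \<beta>] beta_pos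
    by (simp add: g_def e_def power2_eq_square algebra_simps)
  then have gd: "norm g \<le> \<beta> * norm d"
    using beta_pos by (cases "norm g = 0") (auto simp: mult_le_cancel_left)
  have "\<gamma> * (norm e)\<^sup>2 \<le> norm g * norm d"
    using strongly_monotone[of x' x] ge by (simp add: g_def e_def)
  also have "\<dots> \<le> \<beta> * norm d * norm d"
    by (rule mult_right_mono[OF gd norm_ge_zero])
  finally have "(norm e)\<^sup>2 \<le> \<beta> / \<gamma> * (norm d)\<^sup>2"
    using gamma_pos by (simp add: field_simps power2_eq_square)
  then have "norm e \<le> sqrt (\<beta> / \<gamma> * (norm d)\<^sup>2)"
    by (rule real_le_rsqrt)
  also have "\<dots> = sqrt (\<beta> / \<gamma>) * norm d"
    by (simp only: real_sqrt_mult real_sqrt_abs) simp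
  finally show ?thesis
    by (simp add: e_def)
qed

end

section \<open>The smallest eigenvalue of a Gram matrix\<close>

lemma linear_coefficient_zero_if_quadratic_nonneg:
  fixes a b :: real
  assumes nonneg: "\<And>t. 0 \<le> a * t + b * t\<^sup>2"
  shows "a = 0"
proof (rule ccontr)
  assume "a \<noteq> 0"
  define c where "c = \<bar>b\<bar> + 1"
  have "c > 0" "b - c < 0"
    by (auto simp: c_def)
  have "a * (- a / c) + b * (- a / c)\<^sup>2 = a\<^sup>2 * (b - c) / c\<^sup>2"
    using \<open>c > 0\<close> by (simp add: field_simps power2_eq_square)
  also have "\<dots> < 0"
    using \<open>a \<noteq> 0\<close> \<open>c > 0\<close> \<open>b - c < 0\<close> by (simp add: divide_neg_pos mult_pos_neg)
  finally show False
    using nonneg[of "- a / c"] by linarith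
qed

lemma symmetric_matrix_inner:
  fixes A :: "real^'n^'n"
  assumes "transpose A = A"
  shows "(A *v x) \<bullet> y = x \<bullet> (A *v y)"
  by (metis assms dot_lmul_matrix transpose_matrix_vector)

lemma symmetric_matrix_eigenvalues_finite:
  fixes A :: "real^'n^'n"
  assumes sym: "transpose A = A"
  shows "finite {e. \<exists>v. v \<noteq> 0 \<and> A *v v = e *\<^sub>R v}"
proof -
  define E where "E = {e. \<exists>v. v \<noteq> 0 \<and> A *v v = e *\<^sub>R v}"
  define ev where "ev e = (SOME v. v \<noteq> 0 \<and> A *v v = e *\<^sub>R v)" for e
  have ev: "ev e \<noteq> 0 \<and> A *v ev e = e *\<^sub>R ev e" if "e \<in> E" for e
    using that unfolding E_def ev_def by (metis (mono_tags, lifting) mem_Collect_eq someI)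
  have "inj_on ev E"
  proof (rule inj_onI)
    fix a b
    assume "a \<in> E" "b \<in> E" "ev a = ev b"
    then have "a *\<^sub>R ev a = b *\<^sub>R ev a"
      using ev by metis
    then show "a = b"
      using ev[OF \<open>a \<in> E\<close>] by simp
  qed
  have "ev a \<bullet> ev b = 0" if "a \<in> E" "b \<in> E" "a \<noteq> b" for a b
  proof -
    have "a * (ev a \<bullet> ev b) = (A *v ev a) \<bullet> ev b"
      using ev[OF that(1)] by simp
    also have "\<dots> = ev a \<bullet> (A *v ev b)"
      by (rule symmetric_matrix_inner[OF sym])
    also have "\<dots> = b * (ev a \<bullet> ev b)"
      using ev[OF that(2)] by simp
    finally show ?thesis
      using that(3) by simp
  qed
  then have "pairwise orthogonal (ev ` E)"
    unfolding pairwise_def orthogonal_def by (metis imageE)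
  moreover have "0 \<notin> ev ` E"
    using ev by auto
  ultimately have "independent (ev ` E)"
    by (rule pairwise_orthogonal_independent)
  then have "finite (ev ` E)"
    using independent_bound by blast
  then show ?thesis
    using finite_image_iff[OF \<open>inj_on ev E\<close>] by (simp add: E_def)
qed

lemma rayleigh_minimizer_eigenvector:
  fixes A :: "real^'n^'n"
  assumes sym: "transpose A = A" and unit: "norm w0 = 1"
    and min: "\<And>w. (w0 \<bullet> (A *v w0)) * (norm w)\<^sup>2 \<le> w \<bullet> (A *v w)"
  shows "A *v w0 = (w0 \<bullet> (A *v w0)) *\<^sub>R w0"
proof -
  define \<mu> where "\<mu> = w0 \<bullet> (A *v w0)"
  define r where "r = A *v w0 - \<mu> *\<^sub>R w0"
  \<comment> \<open>perturbing \<open>w0\<close> along the residual \<open>r\<close> changes the Rayleigh inequality at first order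
    by \<open>2 t \<parallel>r\<parallel>\<^sup>2\<close>\<close>
  have residual_square: "r \<bullet> r = r \<bullet> (A *v w0) - \<mu> * (r \<bullet> w0)"
    by (simp add: r_def[symmetric] flip: inner_diff_right inner_scaleR_right)
  have "w0 \<bullet> (A *v r) = r \<bullet> (A *v w0)"
    using symmetric_matrix_inner[OF sym, of w0 r] by (simp add: inner_commute)
  then have quadratic_form: "(w0 + t *\<^sub>R r) \<bullet> (A *v (w0 + t *\<^sub>R r))
      = \<mu> + 2 * t * (r \<bullet> (A *v w0)) + t\<^sup>2 * (r \<bullet> (A *v r))" for t
    by (simp add: \<mu>_def matrix_vector_right_distrib matrix_vector_mult_scaleR inner_add_left
        inner_add_right power2_eq_square algebra_simps)
  have "w0 \<bullet> w0 = 1"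
    using unit by (simp add: norm_eq_1)
  then have norm_form: "(norm (w0 + t *\<^sub>R r))\<^sup>2 = 1 + 2 * t * (r \<bullet> w0) + t\<^sup>2 * (norm r)\<^sup>2" for t
    unfolding power2_norm_eq_inner
    by (simp add: inner_add_left inner_add_right inner_commute power2_eq_square algebra_simps)
  have "0 \<le> 2 * (r \<bullet> r) * t + (r \<bullet> (A *v r) - \<mu> * (norm r)\<^sup>2) * t\<^sup>2" for t
    using min[of "w0 + t *\<^sub>R r"] unfolding \<mu>_def[symmetric] quadratic_form norm_form residual_square
    by (simp add: algebra_simps)
  then have "2 * (r \<bullet> r) = 0"
    by (rule linear_coefficient_zero_if_quadratic_nonneg)
  then show ?thesis
    by (simp add: r_def \<mu>_def)
qed

lemma lambda_min_eq_rayleigh_min: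
  fixes A :: "real^'n^'n"
  assumes sym: "transpose A = A" and unit: "norm w0 = 1"
    and min: "\<And>w. (w0 \<bullet> (A *v w0)) * (norm w)\<^sup>2 \<le> w \<bullet> (A *v w)"
  shows "lambda_min A = w0 \<bullet> (A *v w0)"
  unfolding lambda_min_def
proof (rule Min_eqI)
  show "finite {e. \<exists>v. v \<noteq> 0 \<and> A *v v = e *\<^sub>R v}"
    by (rule symmetric_matrix_eigenvalues_finite[OF sym])
  show "w0 \<bullet> (A *v w0) \<in> {e. \<exists>v. v \<noteq> 0 \<and> A *v v = e *\<^sub>R v}"
    using rayleigh_minimizer_eigenvector[OF assms] unit by (intro CollectI exI[of _ w0]) auto
  fix e
  assume "e \<in> {e. \<exists>v. v \<noteq> 0 \<and> A *v v = e *\<^sub>R v}"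
  then obtain v where "v \<noteq> 0" "A *v v = e *\<^sub>R v"
    by blast
  then have "(w0 \<bullet> (A *v w0)) * (norm v)\<^sup>2 \<le> e * (norm v)\<^sup>2"
    using min[of v] by (simp add: power2_norm_eq_inner)
  then show "w0 \<bullet> (A *v w0) \<le> e"
    using \<open>v \<noteq> 0\<close> by simp
qed

lemma gram_matrix_symmetric: "transpose (G ** transpose G) = G ** transpose G" for G :: "real^'n^'m"
  by (simp add: matrix_transpose_mul)

lemma gram_matrix_quadratic_form:
  fixes G :: "real^'n^'m"
  shows "w \<bullet> ((G ** transpose G) *v w) = (norm (w v* G))\<^sup>2"
  by (simp add: power2_norm_eq_inner dot_lmul_matrix flip: matrix_vector_mul_assoc)

lemma vector_matrix_mult_scaleR: "(c *\<^sub>R w) v* G = c *\<^sub>R (w v* G)" for G :: "real^'n^'m"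
  using matrix_vector_mult_scaleR[of "transpose G" c w] by simp

lemma
  fixes G :: "real^'n^'m"
  assumes rank: "rank G = CARD('m)"
  shows lambda_min_gram_pos: "0 < lambda_min (G ** transpose G)"
    and lambda_min_gram_le: "lambda_min (G ** transpose G) * (norm w)\<^sup>2 \<le> (norm (w v* G))\<^sup>2"
proof -
  define q where "q w = (norm (w v* G))\<^sup>2" for w
  have "continuous_on UNIV (\<lambda>w. w v* G)"
    using matrix_vector_mult_linear_continuous_on[of UNIV "transpose G"] by simp
  then have "continuous_on (sphere 0 1) (\<lambda>w. w v* G)"
    by (rule continuous_on_subset) simp
  then have "continuous_on (sphere 0 1) q"
    unfolding q_def by (intro continuous_on_power continuous_on_norm)
  then obtain w0 :: "real^'m" where w0: "norm w0 = 1" and min_sphere: "\<forall>w\<in>sphere 0 1. q w0 \<le> q w"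
    using continuous_attains_inf[of "sphere 0 1" q] by auto
  have "inj ((*v) (transpose G))"
    using rank full_rank_injective[of "transpose G"] by (simp add: rank_transpose)
  then have "inj (\<lambda>w. w v* G)"
    by (simp add: inj_def)
  moreover have "w0 \<noteq> 0"
    using w0 by auto
  ultimately have "w0 v* G \<noteq> 0"
    by (metis injD vector_matrix_mult_0)
  then have "0 < q w0"
    by (simp add: q_def)
  have min: "q w0 * (norm w)\<^sup>2 \<le> q w" for w
  proof (cases "w = 0")
    case False
    then have "q w0 \<le> q ((1 / norm w) *\<^sub>R w)"
      using min_sphere by simp
    then show ?thesis
      using False by (simp add: q_def vector_matrix_mult_scaleR power_divide field_simps)
  qed (simp add: q_def)
  have "lambda_min (G ** transpose G) = q w0"
    using lambda_min_eq_rayleigh_min[OF gram_matrix_symmetric[of G] w0] min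
    by (simp add: gram_matrix_quadratic_form q_def)
  then show "0 < lambda_min (G ** transpose G)"
    and "lambda_min (G ** transpose G) * (norm w)\<^sup>2 \<le> (norm (w v* G))\<^sup>2"
    using \<open>0 < q w0\<close> min by (simp_all add: q_def)
qed

lemma min_norm_preimage:
  fixes G :: "real^'n^'m"
  assumes rank: "rank G = CARD('m)"
  shows "\<exists>d. G *v d = u \<and> norm d \<le> norm u / sqrt (lambda_min (G ** transpose G))"
proof -
  define \<mu> where "\<mu> = lambda_min (G ** transpose G)"
  have pos: "0 < \<mu>" and le: "\<And>w. \<mu> * (norm w)\<^sup>2 \<le> (norm (w v* G))\<^sup>2"
    unfolding \<mu>_def using lambda_min_gram_pos lambda_min_gram_le rank by blast+
  have "inj ((*v) (G ** transpose G))"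
  proof (subst linear_inj_iff_eq_0[OF matrix_vector_mul_linear], intro allI impI)
    fix w
    assume "(G ** transpose G) *v w = 0"
    then have "\<mu> * (norm w)\<^sup>2 \<le> 0"
      using le[of w] gram_matrix_quadratic_form[of w G] by simp
    then show "w = 0"
      using pos by (simp add: mult_le_0_iff)
  qed
  then obtain w where w: "(G ** transpose G) *v w = u"
    by (metis full_rank_injective full_rank_surjective surjD)
  define d where "d = w v* G"
  have "G *v d = u"
    using w by (simp add: d_def flip: matrix_vector_mul_assoc)
  have nd: "(norm d)\<^sup>2 = w \<bullet> u"
    using gram_matrix_quadratic_form[of w G] w by (simp add: d_def)
  also have "\<dots> \<le> norm w * norm u"
    by (rule norm_cauchy_schwarz)
  finally have du: "(norm d)\<^sup>2 \<le> norm w * norm u" .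
  then have "\<mu> * norm w * norm w \<le> norm u * norm w"
    using le[of w] by (simp add: d_def power2_eq_square algebra_simps)
  then have "\<mu> * norm w \<le> norm u"
    by (cases "w = 0") (auto simp: mult_le_cancel_right)
  have "\<mu> * (norm d)\<^sup>2 \<le> (\<mu> * norm w) * norm u"
    using mult_left_mono[OF du, of \<mu>] pos by (simp add: mult.assoc)
  also have "\<dots> \<le> norm u * norm u"
    using \<open>\<mu> * norm w \<le> norm u\<close> by (rule mult_right_mono) simp
  finally have "\<mu> * (norm d)\<^sup>2 \<le> (norm u)\<^sup>2"
    by (simp add: power2_eq_square)
  then have "(norm d)\<^sup>2 \<le> (norm u / sqrt \<mu>)\<^sup>2"
    using pos by (simp add: power_divide field_simps)
  then have "norm d \<le> norm u / sqrt \<mu>"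
    by (rule power2_le_imp_le) (use pos in simp)
  then show ?thesis
    using \<open>G *v d = u\<close> unfolding \<mu>_def by blast
qed


section \<open>Constrained minimisers and the equilibrium\<close>

lemma closed_polyhedron: "closed {y. G *v y \<le> b}" for G :: "real^'n^'m"
  unfolding less_eq_vec_def
  by (simp add: Collect_all_eq closed_INT closed_Collect_le continuous_on_component
      matrix_vector_mult_linear_continuous_on)

lemma convex_polyhedron: "convex {y. G *v y \<le> b}" for G :: "real^'n^'m"
  unfolding convex_def
  by (auto simp: less_eq_vec_def matrix_vector_right_distrib matrix_vector_mult_scaleR
      intro!: convex_bound_le)

lemma polyhedron_nonempty:
  fixes G :: "real^'n^'m"
  assumes "rank G = CARD('m)"
  shows "{y. G *v y \<le> b} \<noteq> {}"
proof -
  obtain y where "G *v y = b"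
    using assms by (metis full_rank_surjective surjD)
  then show ?thesis
    by auto
qed

lemma arg_min_polyhedron_lipschitz:
  fixes F :: "real^'n \<Rightarrow> real" and G :: "real^'n^'m"
  assumes F: "smooth_strongly_convex F \<Gamma> \<gamma> \<beta>" and rank: "rank G = CARD('m)"
  shows "norm (arg_min F (\<lambda>y. G *v y \<le> b') - arg_min F (\<lambda>y. G *v y \<le> b))
    \<le> sqrt (\<beta> / (\<gamma> * lambda_min (G ** transpose G))) * norm (b' - b)"
proof -
  interpret smooth_strongly_convex F \<Gamma> \<gamma> \<beta>
    by (fact F)
  define S where "S c = arg_min F (\<lambda>y. y \<in> {y. G *v y \<le> c})" for c
  note polyhedron = closed_polyhedron convex_polyhedron polyhedron_nonempty[OF rank]
  have S: "G *v S c \<le> c" "\<forall>u\<in>{y. G *v y \<le> c}. 0 \<le> \<Gamma> (S c) \<bullet> (u - S c)" for c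
    using arg_min_in[OF polyhedron] arg_min_variational_inequality[OF polyhedron]
    unfolding S_def by auto
  obtain d where d: "G *v d = b' - b" "norm d \<le> norm (b' - b) / sqrt (lambda_min (G ** transpose G))"
    using min_norm_preimage[OF rank] by blast
  have "S b' - d \<in> {y. G *v y \<le> b}" "S b + d \<in> {y. G *v y \<le> b'}"
    using S(1)[of b] S(1)[of b'] d(1)
    by (auto simp: less_eq_vec_def matrix_vector_mult_diff_distrib matrix_vector_right_distrib)
  then have "norm (S b' - S b) \<le> sqrt (\<beta> / \<gamma>) * norm d"
    by (intro variational_solutions_close[OF S(2)[of b] S(2)[of b']])
  also have "\<dots> \<le> sqrt (\<beta> / \<gamma>) * (norm (b' - b) / sqrt (lambda_min (G ** transpose G)))"
    using d(2) gamma_pos beta_pos by (intro mult_left_mono) auto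
  also have "\<dots> = sqrt (\<beta> / (\<gamma> * lambda_min (G ** transpose G))) * norm (b' - b)"
    by (simp add: real_sqrt_divide real_sqrt_mult)
  finally show ?thesis
    by (simp add: S_def)
qed

lemma constrained_arg_min_lipschitz:
  fixes F :: "real^'n \<Rightarrow> real" and G :: "real^'n^'m" and Dg :: "'x::real_normed_vector \<Rightarrow> (real^'m) measure"
  assumes F: "smooth_strongly_convex F \<Gamma> \<gamma> \<beta>" and rank: "rank G = CARD('m)"
    and int: "\<And>x. integrable (Dg x) (\<lambda>w. w)"
    and W1_le: "\<And>x y. W1 (Dg x) (Dg y) \<le> ennreal (\<epsilon> * norm (x - y))"
  shows "dist (arg_min F (\<lambda>y. G *v y \<le> xi Dg x)) (arg_min F (\<lambda>y. G *v y \<le> xi Dg x'))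
    \<le> sqrt (\<beta> / (\<gamma> * lambda_min (G ** transpose G))) * max \<epsilon> 0 * dist x x'"
proof -
  let ?L = "sqrt (\<beta> / (\<gamma> * lambda_min (G ** transpose G)))"
  have "0 \<le> ?L"
    using smooth_strongly_convex.beta_pos[OF F] smooth_strongly_convex.gamma_pos[OF F]
      lambda_min_gram_pos[OF rank] by simp
  have "dist (arg_min F (\<lambda>y. G *v y \<le> xi Dg x)) (arg_min F (\<lambda>y. G *v y \<le> xi Dg x'))
      \<le> ?L * norm (xi Dg x - xi Dg x')"
    unfolding dist_norm by (rule arg_min_polyhedron_lipschitz[OF F rank])
  also have "\<dots> \<le> ?L * (max \<epsilon> 0 * norm (x - x'))"
    using xi_lipschitz[OF int W1_le] \<open>0 \<le> ?L\<close> by (rule mult_left_mono)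
  finally show ?thesis
    by (simp add: dist_norm mult.assoc)
qed

lemma contraction_iterates_converge:
  fixes T :: "'a::metric_space \<Rightarrow> 'a"
  assumes "0 \<le> q" and lip: "\<And>x y. dist (T x) (T y) \<le> q * dist x y" and fixed: "T xs = xs"
  shows "dist ((T ^^ t) x0) xs \<le> dist x0 xs * q ^ t"
proof (induction t)
  case (Suc t)
  have "dist ((T ^^ Suc t) x0) xs = dist (T ((T ^^ t) x0)) (T xs)"
    by (simp add: fixed)
  also have "\<dots> \<le> q * dist ((T ^^ t) x0) xs"
    by (rule lip)
  also have "\<dots> \<le> q * (dist x0 xs * q ^ t)"
    using Suc \<open>0 \<le> q\<close> by (rule mult_left_mono)
  finally show ?case
    by (simp add: algebra_simps)
qed simp

lemma arg_min_obj_eq_smooth_strongly_convex: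
  fixes l :: "'a::euclidean_space \<Rightarrow> 'z::euclidean_space \<Rightarrow> real" and D :: "'a \<Rightarrow> 'z measure"
  assumes grad: "\<And>x z. GDERIV (\<lambda>x. l x z) x :> gradl x z"
    and prob: "\<And>x. prob_space (D x)" and supp: "\<And>x. AE z in D x. z \<in> Z"
    and int: "\<And>x x'. integrable (D x') (\<lambda>z. l x z)"
    and "0 < \<gamma>" and convex: "\<And>z. z \<in> Z \<Longrightarrow> strongly_convex_on UNIV \<gamma> (\<lambda>x. l x z)"
    and lip_z: "\<And>x z z'. z \<in> Z \<Longrightarrow> z' \<in> Z \<Longrightarrow> norm (gradl x z - gradl x z') \<le> \<beta>z * norm (z - z')"
    and lip_x: "\<And>x y z. z \<in> Z \<Longrightarrow> norm (gradl x z - gradl y z) \<le> \<beta>x * norm (x - y)"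
    and W1_zero: "\<And>x y. W1 (D x) (D y) = 0"
  shows "\<exists>F \<Gamma>. smooth_strongly_convex F \<Gamma> \<gamma> \<beta>x \<and> (\<forall>x P. arg_min (obj D l x) P = arg_min F P)"
proof (intro exI conjI allI)
  define F where "F = obj D l 0"
  have lower: "l y z + gradl y z \<bullet> v + \<gamma> / 2 * (norm v)\<^sup>2 \<le> l (y + v) z" if "z \<in> Z" for z y v
    by (rule strongly_convex_on_gradient_lower_bound[OF grad convex[OF that]])
  have upper: "l (y + v) z \<le> l y z + gradl y z \<bullet> v + \<beta>x / 2 * (norm v)\<^sup>2" if "z \<in> Z" for z y v
    by (rule lipschitz_gradient_upper_bound[OF grad lip_x[OF that]])
  show "smooth_strongly_convex F (\<lambda>y. \<integral>z. gradl y z \<partial>D 0) \<gamma> \<beta>x"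
    using expectation_lower_bound[OF prob grad int supp lower upper]
      expectation_upper_bound[OF prob grad int supp lower upper] \<open>0 < \<gamma>\<close>
    by unfold_locales (simp_all add: F_def obj_def)
  fix x P
  define c where "c = obj D l x 0 - F 0"
  have "obj D l x y = F y + c" for y
  proof -
    have lip: "norm ((l y z - l 0 z) - (l y z' - l 0 z')) \<le> (\<beta>z * norm y) * dist z z'"
      if "z \<in> Z" "z' \<in> Z" for z z'
      using mixed_difference_le[OF grad lip_z[OF that], of y 0] by (simp add: dist_norm algebra_simps)
    have "(\<integral>z. l y z - l 0 z \<partial>D x) = (\<integral>z. l y z - l 0 z \<partial>D 0)"
      by (rule integral_eq_if_W1_zero[OF W1_zero _ _ supp supp lip]) (use int in auto)
    then show ?thesis
      using int by (simp add: c_def F_def obj_def)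
  qed
  then show "arg_min (obj D l x) P = arg_min F P"
    by (simp add: arg_min_def is_arg_min_def)
qed

theorem corollary1:
  fixes G :: "real^'n^'m"
    and l :: "real^'n \<Rightarrow> 'z::euclidean_space \<Rightarrow> real"
    and gradl :: "real^'n \<Rightarrow> 'z \<Rightarrow> real^'n"
    and Z :: "'z set" and W :: "(real^'m) set"
    and D :: "real^'n \<Rightarrow> 'z measure"
    and Dg :: "real^'n \<Rightarrow> (real^'m) measure"
    and \<gamma> \<beta>z \<beta>x \<epsilon> \<epsilon>g :: real
  assumes l_C2: "twice_cont_diff (\<lambda>p. l (fst p) (snd p))"
    and gradl: "\<And>x z. GDERIV (\<lambda>x. l x z) x :> gradl x z"
    and D_prob: "\<And>x. prob_space (D x)" and D_sets: "\<And>x. sets (D x) = sets borel"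
    and D_supp: "\<And>x. AE z in D x. z \<in> Z"
    and Dg_prob: "\<And>x. prob_space (Dg x)" and Dg_sets: "\<And>x. sets (Dg x) = sets borel"
    and Dg_supp: "\<And>x. AE w in Dg x. w \<in> W"
    and l_int: "\<And>x x'. integrable (D x') (\<lambda>z. l x z)"
    and w_int: "\<And>x'. integrable (Dg x') (\<lambda>w. w)"
    and eps0: "\<epsilon> = 0"
    and gamma_pos: "\<gamma> > 0"
    and A1: "\<And>z. z \<in> Z \<Longrightarrow> strongly_convex_on UNIV \<gamma> (\<lambda>x. l x z)"
    and A2z: "\<And>x z z'. z \<in> Z \<Longrightarrow> z' \<in> Z \<Longrightarrow> norm (gradl x z - gradl x z') \<le> \<beta>z * norm (z - z')"
    and A2x: "\<And>x y z. z \<in> Z \<Longrightarrow> norm (gradl x z - gradl y z) \<le> \<beta>x * norm (x - y)"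
    and A3: "\<And>x y. W1 (D x) (D y) \<le> ennreal (\<epsilon> * norm (x - y))"
    and A3g: "\<And>x y. W1 (Dg x) (Dg y) \<le> ennreal (\<epsilon>g * norm (x - y))"
    and A4: "rank G = CARD('m)"
    and contr: "sqrt (\<beta>x / (\<gamma> * lambda_min (G ** transpose G))) * \<epsilon>g < 1"
  shows "(\<exists>!xs. constrained_equilibrium D l G Dg xs) \<and>
         (\<exists>q. 0 \<le> q \<and> q < 1 \<and>
            (\<forall>xs x0. constrained_equilibrium D l G Dg xs \<longrightarrow>
               (\<exists>C. \<forall>t. norm (RCM D l G Dg x0 t - xs) \<le> C * q ^ t)))"
proof -
  have "W1 (D x) (D y) = 0" for x y
    using A3[of x y] eps0 by simp
  then obtain F \<Gamma> where F: "smooth_strongly_convex F \<Gamma> \<gamma> \<beta>x"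
    and arg_min_obj: "\<And>x P. arg_min (obj D l x) P = arg_min F P"
    using arg_min_obj_eq_smooth_strongly_convex[where D = D,
        OF gradl D_prob D_supp l_int gamma_pos A1 A2z A2x]
    by blast
  define T where "T x = arg_min F (\<lambda>y. G *v y \<le> xi Dg x)" for x
  define q where "q = sqrt (\<beta>x / (\<gamma> * lambda_min (G ** transpose G))) * max \<epsilon>g 0"
  have T_lip: "dist (T x) (T y) \<le> q * dist x y" for x y
    unfolding T_def q_def by (rule constrained_arg_min_lipschitz[OF F A4 w_int A3g])
  have "0 \<le> q" "q < 1"
    using smooth_strongly_convex.beta_pos[OF F] gamma_pos lambda_min_gram_pos[OF A4] contr
    by (auto simp: q_def max_def)
  have equilibrium_iff: "constrained_equilibrium D l G Dg xs \<longleftrightarrow> T xs = xs" for xs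
    by (auto simp: constrained_equilibrium_def arg_min_obj T_def)
  have RCM_iterate: "RCM D l G Dg x0 t = (T ^^ t) x0" for x0 t
    by (induction t) (simp_all add: arg_min_obj T_def)
  show ?thesis
  proof
    show "\<exists>!xs. constrained_equilibrium D l G Dg xs"
      unfolding equilibrium_iff using banach_fix_type[OF \<open>0 \<le> q\<close> \<open>q < 1\<close>] T_lip by blast
    have "norm (RCM D l G Dg x0 t - xs) \<le> dist x0 xs * q ^ t"
      if "constrained_equilibrium D l G Dg xs" for xs x0 t
      using that contraction_iterates_converge[OF \<open>0 \<le> q\<close> T_lip]
      by (simp add: equilibrium_iff RCM_iterate dist_norm)
    then show "\<exists>q. 0 \<le> q \<and> q < 1 \<and> (\<forall>xs x0. constrained_equilibrium D l G Dg xs \<longrightarrow>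
        (\<exists>C. \<forall>t. norm (RCM D l G Dg x0 t - xs) \<le> C * q ^ t))"
      using \<open>0 \<le> q\<close> \<open>q < 1\<close> by blast
  qed
qed

end
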